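(* Let $N$ be a positive integer. For the Laguerre ensemble of $N\times N$ matrices and every complex $u\neq0$ with $\mathrm{Re}\,u<1$, the exponential mean is given by the exact formula $$\Bigl\langle \mathrm{tr}\, e^{NuH} \Bigr\rangle=\frac 1u\, \frac 1{2\pi i} \oint_{C_0} dz\, \frac{(z-1)^N}{(z+u-1)^N}\,\frac{(z+u)^N}{z^N}=\frac 1u\, \frac 1{2\pi i} \oint_{C_0} dz\, \Bigl(1+\frac 1{z+u-1}\Bigr)^N \Bigl(1-\frac 1z\Bigr)^N ,$$ where $C_0$ is a small positively oriented contour encircling $z=0$ but not $z=1-u$.
   Context: The Laguerre ensemble: the eigenvalues $\lambda_1,\dots,\lambda_N\in[0,\infty)$ of the positive-definite Hermitian $N\times N$ matrix $H$ have joint probability density proportional to $\prod_{i<j}(\lambda_i-\lambda_j)^2\,e^{-N\sum_i\lambda_i}$; $\langle\cdot\rangle$ is the expectation and $\mathrm{tr}\,e^{NuH}=\sum_i e^{Nu\lambda_i}$. *)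

theory Defs
  imports
    "HOL-Probability.Probability"
    "HOL-Complex_Analysis.Complex_Analysis"
    "Jordan_Normal_Form.Schur_Decomposition"
begin

definition mat_trace :: "complex mat \<Rightarrow> complex"
  where "mat_trace A = (\<Sum>i<dim_row A. A $$ (i, i))"

text \<open>The exponential series is summed entrywise.\<close>

definition mat_exp :: "complex mat \<Rightarrow> complex mat"
  where "mat_exp A =
    mat (dim_row A) (dim_row A) (\<lambda>(i, j). \<Sum>k. (A ^\<^sub>m k) $$ (i, j) / fact k)"

text \<open>Since \<open>x \<bullet>c y\<close> conjugates its second argument, the quadratic form below is
  \<open>v\<^sup>* A v\<close>; in the order on complex numbers, \<open>0 < z\<close> means that \<open>z\<close> is real and positive.\<close>

definition pos_def_hermitian :: "nat \<Rightarrow> complex mat \<Rightarrow> bool"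
  where "pos_def_hermitian N A \<longleftrightarrow>
    A \<in> carrier_mat N N \<and> mat_adjoint A = A \<and>
    (\<forall>v \<in> carrier_vec N. v \<noteq> 0\<^sub>v N \<longrightarrow> 0 < (A *\<^sub>v v) \<bullet>c v)"

definition laguerre_weight :: "nat \<Rightarrow> (nat \<Rightarrow> real) \<Rightarrow> real"
  where "laguerre_weight N x =
    (if \<forall>i<N. 0 \<le> x i
     then (\<Prod>(i, j) \<in> {(i, j). i < j \<and> j < N}. (x i - x j)\<^sup>2) * exp (- real N * (\<Sum>i<N. x i))
     else 0)"

text \<open>A random positive definite Hermitian matrix \<open>H\<close> on a probability space \<open>M\<close>, together with a
  labelling \<open>lam 0, \<dots>, lam (N - 1)\<close> of its eigenvalues (with multiplicity) whose joint
  density is proportional to the Laguerre weight. The constant \<open>c\<close> is the reciprocal of the partition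
  function: it is determined by the total mass of \<open>M\<close> being 1.\<close>

definition laguerre_ensemble ::
  "nat \<Rightarrow> 'a measure \<Rightarrow> ('a \<Rightarrow> complex mat) \<Rightarrow> (nat \<Rightarrow> 'a \<Rightarrow> real) \<Rightarrow> bool"
  where "laguerre_ensemble N M H lam \<longleftrightarrow>
    prob_space M \<and>
    (\<forall>i<N. \<forall>j<N. (\<lambda>\<omega>. H \<omega> $$ (i, j)) \<in> borel_measurable M) \<and>
    (\<forall>\<omega> \<in> space M. pos_def_hermitian N (H \<omega>)) \<and>
    (\<forall>\<omega> \<in> space M. char_poly (H \<omega>) = (\<Prod>i<N. [:- complex_of_real (lam i \<omega>), 1:])) \<and>
    (\<exists>c>0. distributed M (\<Pi>\<^sub>M i\<in>{..<N}. lborel) (\<lambda>\<omega>. \<lambda>i\<in>{..<N}. lam i \<omega>)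
             (\<lambda>x. ennreal (c * laguerre_weight N x)))"

text \<open>A closed contour that winds once, counterclockwise, around \<open>a\<close> and does not encircle \<open>b\<close>.\<close>

definition encircles_once_not :: "(real \<Rightarrow> complex) \<Rightarrow> complex \<Rightarrow> complex \<Rightarrow> bool"
  where "encircles_once_not \<gamma> a b \<longleftrightarrow>
    valid_path \<gamma> \<and> pathfinish \<gamma> = pathstart \<gamma> \<and>
    a \<notin> path_image \<gamma> \<and> b \<notin> path_image \<gamma> \<and>
    winding_number \<gamma> a = 1 \<and> winding_number \<gamma> b = 0"

end

theory Submission
  imports Defs "Jordan_Normal_Form.Jordan_Normal_Form"
begin

text \<open>
  The Vandermonde product is, up to a constant, the determinant of the rescaled Laguerre polynomials
  \<open>L\<^sub>j(N x)\<close>, so the Leibniz expansion of its square and orthonormality turn the mean of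
  \<open>\<Sum>\<^sub>i exp (N u \<lambda>\<^sub>i)\<close> into a constant times the sum over \<open>j < N\<close> of the Laplace transforms of
  \<open>L\<^sub>j\<^sup>2\<close> at \<open>s = 1 - u\<close>; the case \<open>u = 0\<close> shows that the constant is 1. Since \<open>L\<^sub>i(t)\<close> is the
  residue at \<open>z = 0\<close> of \<open>exp (t z) (1 - 1/z)\<^sup>i / z\<close>, the transform of \<open>L\<^sub>i L\<^sub>j\<close> is the residue at 0 of
  \<open>(1 - 1/z)\<^sup>i / z \<cdot> (1 - 1/(s - z))\<^sup>j / (s - z)\<close>. At \<open>s = 1\<close> this gives orthonormality. For
  \<open>i = j\<close> and \<open>s = 1 - u\<close>, \<open>u\<close> times it is the difference of consecutive powers of
  \<open>(z - 1)(z + u) / (z (z + u - 1))\<close>, so the sum over \<open>j\<close> telescopes.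
\<close>

section \<open>Trace of the matrix exponential\<close>

lemma mat_trace_mult_comm:
  assumes "A \<in> carrier_mat n m" "B \<in> carrier_mat m n"
  shows "mat_trace (A * B) = mat_trace (B * A)"
proof -
  have "mat_trace (A * B) = (\<Sum>i<n. \<Sum>k<m. A $$ (i, k) * B $$ (k, i))"
    using assms by (auto simp: mat_trace_def scalar_prod_def lessThan_atLeast0 intro!: sum.cong)
  also have "\<dots> = (\<Sum>k<m. \<Sum>i<n. B $$ (k, i) * A $$ (i, k))"
    by (subst sum.swap) (simp add: mult.commute)
  also have "\<dots> = mat_trace (B * A)"
    using assms by (auto simp: mat_trace_def scalar_prod_def lessThan_atLeast0 intro!: sum.cong)
  finally show ?thesis .
qed

lemma mat_trace_similar:
  assumes "A \<in> carrier_mat n n" and sim: "similar_mat_wit A B P Q"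
  shows "mat_trace A = mat_trace B"
proof -
  note w = similar_mat_witD2[OF assms]
  have "mat_trace A = mat_trace (P * B * Q)"
    using w by simp
  also have "\<dots> = mat_trace (Q * (P * B))"
    by (rule mat_trace_mult_comm) (use w in auto)
  also have "Q * (P * B) = B"
    using assoc_mult_mat[OF w(7) w(6) w(5)] w(2) left_mult_one_mat[OF w(5)] by simp
  finally show ?thesis .
qed

lemma upper_triangular_pow_mat:
  fixes B :: "complex mat"
  assumes B: "B \<in> carrier_mat n n" and ut: "upper_triangular B"
  shows "upper_triangular (B ^\<^sub>m k) \<and> (\<forall>i<n. (B ^\<^sub>m k) $$ (i, i) = (B $$ (i, i)) ^ k)"
proof (induction k)
  case 0
  show ?case by (simp add: carrier_matD[OF B] upper_triangular_def)
next
  case (Suc k)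
  have entry: "(B ^\<^sub>m Suc k) $$ (i, j) = (\<Sum>l<n. (B ^\<^sub>m k) $$ (i, l) * B $$ (l, j))"
    if "i < n" "j < n" for i j
    using that B by (simp add: scalar_prod_def lessThan_atLeast0)
  \<comment> \<open>In the entry \<open>(i, j)\<close> of the product, \<open>l < i\<close> kills
    the first factor and \<open>j < l\<close> the second. So no term survives below the diagonal,
    and only \<open>l = i\<close> survives on it.\<close>
  have low: "(B ^\<^sub>m k) $$ (i, l) = 0" "B $$ (i, l) = 0" if "l < i" "i < n" for i l
    using that Suc ut B by (auto dest: upper_triangularD)
  have "(B ^\<^sub>m Suc k) $$ (i, j) = 0" if "j < i" "i < n" for i j
  proof -
    have "(B ^\<^sub>m k) $$ (i, l) * B $$ (l, j) = 0" if "l < n" for l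
      using low[of l i] low[of j l] that \<open>j < i\<close> \<open>i < n\<close> by (cases "l < i") auto
    then have "(\<Sum>l<n. (B ^\<^sub>m k) $$ (i, l) * B $$ (l, j)) = 0"
      by (intro sum.neutral) blast
    with that show ?thesis by (simp add: entry del: pow_mat.simps)
  qed
  moreover have "(B ^\<^sub>m Suc k) $$ (i, i) = (B $$ (i, i)) ^ Suc k" if "i < n" for i
  proof -
    have "(B ^\<^sub>m Suc k) $$ (i, i) = (\<Sum>l<n. if l = i then (B ^\<^sub>m k) $$ (i, i) * B $$ (i, i) else 0)"
      unfolding entry[OF that that]
    proof (intro sum.cong refl)
      fix l assume "l \<in> {..<n}"
      then show "(B ^\<^sub>m k) $$ (i, l) * B $$ (l, i)
          = (if l = i then (B ^\<^sub>m k) $$ (i, i) * B $$ (i, i) else 0)"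
        using low[of l i] low[of i l] that by (cases l i rule: linorder_cases) auto
    qed
    then show ?thesis
      using that Suc by (simp del: pow_mat.simps)
  qed
  ultimately show ?case
    using pow_carrier_mat[OF B, of "Suc k"] unfolding upper_triangular_def
    by (simp only: carrier_matD(1)) blast
qed

text \<open>If \<open>b\<close> bounds the entries of \<open>A\<close>, then
  \<open>(b * n) ^ k\<close> bounds those of the \<open>k\<close>-th power, so the exponential
  series of \<open>b * n\<close> dominates. This is what allows the trace to be exchanged with the
  series.\<close>

lemma summable_pow_mat_entry:
  fixes A :: "complex mat"
  assumes A: "A \<in> carrier_mat n n" and "i < n" "j < n"
  shows "summable (\<lambda>k. (A ^\<^sub>m k) $$ (i, j) / fact k)"
proof -
  obtain b where b: "norm_bound A b" using norm_bound_max by blast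
  have "0 \<le> norm (A $$ (i, j))" by simp
  also have "\<dots> \<le> b" using b A assms by (auto simp: norm_bound_def)
  finally have "b \<ge> 0" .
  have bound: "norm_bound (A ^\<^sub>m k) ((b * n) ^ k)" for k
  proof (induction k)
    case 0
    then show ?case using A by (auto simp: norm_bound_def one_mat_def)
  next
    case (Suc k)
    from norm_bound_mult[OF pow_carrier_mat[OF A] A Suc b] show ?case by (simp add: mult_ac)
  qed
  have "summable (\<lambda>k. (b * n) ^ k / fact k)"
    using summable_exp[of "b * n"] by (simp add: divide_inverse mult.commute)
  then show ?thesis
  proof (rule summable_comparison_test'[where N = 0])
    fix k :: nat
    have "norm ((A ^\<^sub>m k) $$ (i, j)) \<le> (b * n) ^ k"
      using bound[of k] A assms by (auto simp: norm_bound_def)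
    then show "norm ((A ^\<^sub>m k) $$ (i, j) / fact k) \<le> (b * n) ^ k / fact k"
      by (simp add: norm_divide divide_right_mono)
  qed
qed

text \<open>Similarity preserves the trace of every power, and the powers of a triangular matrix
  have powers of its diagonal entries on the diagonal. Exchanging the finite sum with the series
  twice reassembles scalar exponentials.\<close>

lemma mat_trace_mat_exp_similar:
  assumes A: "A \<in> carrier_mat n n" and sim: "similar_mat_wit A B P Q" and ut: "upper_triangular B"
  shows "mat_trace (mat_exp A) = (\<Sum>i<n. exp (B $$ (i, i)))"
proof -
  have B: "B \<in> carrier_mat n n"
    using similar_mat_witD2[OF A sim] by blast
  have tr: "(\<Sum>i<n. (A ^\<^sub>m k) $$ (i, i)) = (\<Sum>i<n. B $$ (i, i) ^ k)" for k
  proof -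
    have "mat_trace (A ^\<^sub>m k) = mat_trace (B ^\<^sub>m k)"
      by (rule mat_trace_similar[OF pow_carrier_mat[OF A] similar_mat_wit_pow[OF sim]])
    then show ?thesis
      using A B upper_triangular_pow_mat[OF B ut, of k] by (simp add: mat_trace_def)
  qed
  have summB: "summable (\<lambda>k. B $$ (i, i) ^ k / fact k)" for i
    using summable_exp[of "B $$ (i, i)"] by (simp add: divide_inverse mult.commute)
  have "mat_trace (mat_exp A) = (\<Sum>i<n. \<Sum>k. (A ^\<^sub>m k) $$ (i, i) / fact k)"
    using A by (simp add: mat_trace_def mat_exp_def)
  also have "\<dots> = (\<Sum>k. \<Sum>i<n. (A ^\<^sub>m k) $$ (i, i) / fact k)"
    by (rule suminf_sum[symmetric]) (use A in \<open>auto intro: summable_pow_mat_entry\<close>)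
  also have "\<dots> = (\<Sum>k. \<Sum>i<n. B $$ (i, i) ^ k / fact k)"
    by (simp add: tr flip: sum_divide_distrib)
  also have "\<dots> = (\<Sum>i<n. \<Sum>k. B $$ (i, i) ^ k / fact k)"
    by (rule suminf_sum[OF summB])
  also have "\<dots> = (\<Sum>i<n. exp (B $$ (i, i)))"
    by (simp add: exp_def scaleR_conv_of_real divide_inverse mult.commute)
  finally show ?thesis .
qed

text \<open>The splitting of the characteristic polynomial supplies a Schur form whose diagonal is
  the given list of eigenvalues; scaling by \<open>c\<close> keeps the form triangular and the
  similarity unchanged.\<close>

lemma mat_trace_mat_exp_smult:
  assumes A: "A \<in> carrier_mat n n" and char: "char_poly A = (\<Prod>i<n. [:- l i, 1:])"
  shows "mat_trace (mat_exp (c \<cdot>\<^sub>m A)) = (\<Sum>i<n. exp (c * l i))"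
proof -
  obtain B P Q where schur: "schur_decomposition A (map l [0..<n]) = (B, P, Q)"
    by (cases "schur_decomposition A (map l [0..<n])") auto
  have "char_poly A = (\<Prod>e\<leftarrow>map l [0..<n]. [:- e, 1:])"
    unfolding char by (simp add: prod.list_conv_set_nth lessThan_atLeast0 comp_def)
  from schur_decomposition[OF A this schur] have sim: "similar_mat_wit A B P Q"
    and ut: "upper_triangular B" and diag: "diag_mat B = map l [0..<n]" by auto
  note w = similar_mat_witD2[OF A sim]
  have "similar_mat_wit (c \<cdot>\<^sub>m A) (c \<cdot>\<^sub>m B) P Q"
    by (rule similar_mat_wit_smult[OF sim])
  moreover have "upper_triangular (c \<cdot>\<^sub>m B)"
    using ut w by (auto intro!: upper_triangularI dest: upper_triangularD)
  ultimately have "mat_trace (mat_exp (c \<cdot>\<^sub>m A)) = (\<Sum>i<n. exp ((c \<cdot>\<^sub>m B) $$ (i, i)))"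
    by (intro mat_trace_mat_exp_similar[of _ n]) (use A in auto)
  also have "\<dots> = (\<Sum>i<n. exp (c * l i))"
  proof (intro sum.cong refl)
    fix i assume "i \<in> {..<n}"
    moreover have "diag_mat B ! i = l i" if "i < n" using that diag by simp
    ultimately show "exp ((c \<cdot>\<^sub>m B) $$ (i, i)) = exp (c * l i)"
      using w by (simp add: diag_mat_def)
  qed
  finally show ?thesis .
qed

section \<open>Determinants and orthonormal functions\<close>

text \<open>Laplace expansion along row \<open>n\<close>: its cofactors do not see that row, so as a
  function of the last point the determinant is a fixed linear combination of the polynomials. The
  last cofactor is the determinant of size \<open>n\<close>, which feeds the induction
  below.\<close>

lemma det_laplace_last_row_poly:
  fixes p :: "nat \<Rightarrow> 'a :: idom poly" and x :: "nat \<Rightarrow> 'a"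
  shows "\<exists>c. c n = det (mat n n (\<lambda>(i, j). poly (p j) (x i))) \<and>
    (\<forall>t. det (mat (Suc n) (Suc n) (\<lambda>(i, j). poly (p j) ((x(n := t)) i))) = (\<Sum>j<Suc n. poly (p j) t * c j))"
proof -
  define A where "A t = mat (Suc n) (Suc n) (\<lambda>(i, j). poly (p j) ((x(n := t)) i))" for t
  have A: "A t \<in> carrier_mat (Suc n) (Suc n)" for t by (simp add: A_def)
  \<comment> \<open>The point 0 is an arbitrary choice, since deleting row \<open>n\<close> removes
    all dependence on \<open>t\<close>.\<close>
  define c where "c j = cofactor (A 0) n j" for j
  have c: "cofactor (A t) n j = c j" if "j < Suc n" for t j
  proof -
    have "mat_delete (A t) n j = mat_delete (A 0) n j"
      using that by (auto simp: A_def mat_delete_def intro!: eq_matI)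
    then show ?thesis by (simp add: c_def cofactor_def)
  qed
  have "mat_delete (A 0) n n = mat n n (\<lambda>(i, j). poly (p j) (x i))"
    by (auto simp: A_def mat_delete_def intro!: eq_matI)
  then have "c n = det (mat n n (\<lambda>(i, j). poly (p j) (x i)))"
    by (simp add: c_def cofactor_def)
  moreover have "det (A t) = (\<Sum>j<Suc n. poly (p j) t * c j)" for t
    by (subst laplace_expansion_row[OF A, of n]) (auto simp: c simp del: sum.lessThan_Suc, simp add: A_def)
  ultimately show ?thesis unfolding A_def by blast
qed

text \<open>Induction on the size: as a polynomial in the last point the determinant has degree at
  most \<open>n\<close>, its coefficient at \<open>n\<close> is known, and it vanishes at the
  \<open>n\<close> earlier points because two rows coincide there. If these are distinct, that
  determines it.\<close>

lemma det_poly_eq_vandermonde: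
  fixes p :: "nat \<Rightarrow> 'a :: idom poly" and x :: "nat \<Rightarrow> 'a"
  assumes deg: "\<And>j. degree (p j) \<le> j"
  shows "det (mat n n (\<lambda>(i, j). poly (p j) (x i)))
    = (\<Prod>j<n. coeff (p j) j) * (\<Prod>i<n. \<Prod>k<i. x i - x k)"
proof (induction n)
  case 0
  then show ?case by simp
next
  case (Suc n)
  let ?A = "\<lambda>x. mat (Suc n) (Suc n) (\<lambda>(i, j). poly (p j) (x i))"
  have same: "det (?A y) = 0" if "i < Suc n" "m < Suc n" "i \<noteq> m" "y i = y m" for y i m
  proof (rule det_identical_rows[OF _ that(3,1,2)])
    show "row (?A y) i = row (?A y) m"
      using that(1,2) by (intro eq_vecI) (simp_all add: that(4))
  qed simp
  from det_laplace_last_row_poly[of n p x] obtain c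
    where cn: "c n = det (mat n n (\<lambda>(i, j). poly (p j) (x i)))"
    and lap: "\<And>t. det (?A (x(n := t))) = (\<Sum>j<Suc n. poly (p j) t * c j)" by blast
  show ?case
  proof (cases "inj_on x {..<n}")
    case False
    \<comment> \<open>A repetition among the first \<open>n\<close> points makes both sides zero:
      two rows agree, and \<open>x m - x i\<close> is a factor of the product.\<close>
    then obtain i m where im: "i < m" "m < n" "x i = x m"
      unfolding inj_on_def by (metis lessThan_iff linorder_neqE_nat)
    then have "det (?A x) = 0" by (intro same[of i m]) auto
    moreover have z: "(\<Prod>k<m. x m - x k) = 0"
      using im by (intro prod_zero bexI[of _ i]) auto
    have "(\<Prod>i<Suc n. \<Prod>k<i. x i - x k) = 0"
    proof (rule prod_zero)
      show "\<exists>i\<in>{..<Suc n}. (\<Prod>k<i. x i - x k) = 0"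
        by (rule bexI, rule z) (use im in simp)
    qed simp
    ultimately show ?thesis by simp
  next
    case True
    define q where "q = (\<Sum>j<Suc n. Polynomial.smult (c j) (p j))"
    define r where "r = Polynomial.smult (coeff (p n) n * c n) (\<Prod>k<n. [:- x k, 1:])"
    have q: "poly q t = det (?A (x(n := t)))" for t
      by (simp only: q_def lap poly_sum poly_smult mult.commute)
    have deg_prod: "degree (\<Prod>k<n. [:- x k, 1:]) = n" by (subst degree_prod_eq_sum_degree) auto
    have "lead_coeff (\<Prod>k<n. [:- x k, 1:]) = 1" by (simp add: lead_coeff_prod)
    then have lead: "coeff (\<Prod>k<n. [:- x k, 1:]) n = 1" by (simp add: deg_prod)
    have "q = r"
    proof (rule poly_eqI_degree_lead_coeff[where A = "x ` {..<n}" and n = n])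
      have "coeff (p j) n = 0" if "j < n" for j
        using deg[of j] that by (intro coeff_eq_0) auto
      then show "coeff q n = coeff r n"
        by (simp add: q_def r_def lead coeff_sum mult.commute)
      show "card (x ` {..<n}) \<ge> n" using True by (simp add: card_image)
      have "degree (Polynomial.smult (c j) (p j)) \<le> n" if "j < Suc n" for j
        using order_trans[OF degree_smult_le deg, of "c j" j] that by linarith
      then show "degree q \<le> n" unfolding q_def by (intro degree_sum_le) auto
      show "degree r \<le> n" unfolding r_def using degree_smult_le deg_prod by metis
      fix z assume "z \<in> x ` {..<n}"
      then obtain m where m: "m < n" "z = x m" by auto
      then have "poly q z = 0"
        unfolding q by (intro same[of m n]) auto
      moreover have "poly r z = 0"
        using m by (auto simp: r_def poly_prod)
      ultimately show "poly q z = poly r z" by simp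
    qed
    then have "det (?A x) = coeff (p n) n * c n * (\<Prod>k<n. x n - x k)"
      using q[of "x n"] by (simp add: r_def poly_prod)
    then show ?thesis
      by (simp add: cn Suc.IH mult_ac)
  qed
qed

lemma prod_pairs_squared_diff:
  fixes x :: "nat \<Rightarrow> real"
  shows "(\<Prod>(i, j) \<in> {(i, j). i < j \<and> j < n}. (x i - x j)\<^sup>2) = (\<Prod>i<n. \<Prod>k<i. x i - x k)\<^sup>2"
proof -
  have "(\<Prod>i<n. \<Prod>k<i. x i - x k)\<^sup>2 = (\<Prod>(i, k)\<in>Sigma {..<n} (\<lambda>i. {..<i}). (x i - x k)\<^sup>2)"
    by (subst prod.Sigma[symmetric]) (auto simp: prod_power_distrib)
  also have "\<dots> = (\<Prod>(i, j) \<in> {(i, j). i < j \<and> j < n}. (x i - x j)\<^sup>2)"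
    by (rule prod.reindex_bij_witness[of _ "\<lambda>(i, j). (j, i)" "\<lambda>(i, j). (j, i)"]) (auto simp: power2_commute)
  finally show ?thesis ..
qed

section \<open>Means of sums over the points of a determinantal density\<close>

text \<open>Outside \<open>k\<close> both maps use up the same values, so only one value is left for
  \<open>k\<close>. Hence distinct permutations differ at some index other than a prescribed one,
  which is what orthogonality needs below.\<close>

lemma permutes_eqI_except:
  assumes "p permutes S" "q permutes S" and "\<And>i. i \<noteq> k \<Longrightarrow> p i = q i"
  shows "p = q"
proof
  fix i
  obtain m where m: "q m = p k" using permutes_surj[OF assms(2)] by (metis surjD)
  have "m = k"
  proof (rule ccontr)
    assume "m \<noteq> k"
    then have "p m = p k" using assms(3)[of m] m by simp
    then show False using permutes_inj[OF assms(1)] \<open>m \<noteq> k\<close> by (simp add: inj_eq)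
  qed
  then show "p i = q i" using m assms(3)[of i] by (cases "i = k") simp_all
qed

text \<open>The Leibniz formula turns the squared determinant into a sum over pairs of permutations,
  and each integral factors over the coordinates. With \<open>f\<close> in coordinate
  \<open>k\<close>, orthogonality in the other coordinates leaves only equal permutations, whose
  signs square to 1.\<close>

lemma orthonormal_determinantal_mean:
  fixes \<phi> :: "nat \<Rightarrow> 'b \<Rightarrow> complex" and W f :: "'b \<Rightarrow> complex" and n :: nat
  assumes "sigma_finite_measure \<nu>"
    and int: "\<And>a b. integrable \<nu> (\<lambda>t. \<phi> a t * \<phi> b t * W t)"
    and orth: "\<And>a b. (\<integral>t. \<phi> a t * \<phi> b t * W t \<partial>\<nu>) = (if a = b then 1 else 0)"
    and intf: "\<And>a b. integrable \<nu> (\<lambda>t. \<phi> a t * \<phi> b t * W t * f t)"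
  defines "F \<equiv> (\<lambda>x. (\<Sum>k<n. f (x k)) * ((det (mat n n (\<lambda>(i, j). \<phi> j (x i))))\<^sup>2 * (\<Prod>i<n. W (x i))))"
  shows "integrable (\<Pi>\<^sub>M i\<in>{..<n}. \<nu>) F"
    and "integral\<^sup>L (\<Pi>\<^sub>M i\<in>{..<n}. \<nu>) F = fact n * (\<Sum>j<n. \<integral>t. \<phi> j t * \<phi> j t * W t * f t \<partial>\<nu>)"
proof -
  interpret sigma_finite_measure \<nu> by fact
  interpret product_sigma_finite "\<lambda>_::nat. \<nu>" by unfold_locales
  let ?S = "{p. p permutes {..<n}}"
  let ?P = "\<Pi>\<^sub>M i\<in>{..<n}. \<nu>"
  define B where "B a b = (\<integral>t. \<phi> a t * \<phi> b t * W t * f t \<partial>\<nu>)" for a b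
  \<comment> \<open>The factor \<open>f\<close> is absorbed into coordinate \<open>k\<close>, so
    that each summand becomes a pure product over coordinates.\<close>
  define h where "h k \<sigma> \<tau> i t = (\<phi> (\<sigma> i) t * \<phi> (\<tau> i) t * W t * (if i = k then f t else 1))"
    for k :: nat and \<sigma> \<tau> :: "nat \<Rightarrow> nat" and i t
  have fin: "finite ?S" by (rule finite_permutations) simp
  have "F x = (\<Sum>k<n. \<Sum>\<sigma>\<in>?S. \<Sum>\<tau>\<in>?S. signof \<sigma> * signof \<tau> * (\<Prod>i<n. h k \<sigma> \<tau> i (x i)))" for x
  proof -
    have det: "det (mat n n (\<lambda>(i, j). \<phi> j (x i))) = (\<Sum>\<sigma>\<in>?S. signof \<sigma> * (\<Prod>i<n. \<phi> (\<sigma> i) (x i)))"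
      by (subst det_def'[of _ n])
         (auto simp: atLeast0LessThan permutes_in_image intro!: sum.cong prod.cong)
    have "F x = (\<Sum>k<n. f (x k) * ((\<Sum>\<sigma>\<in>?S. \<Sum>\<tau>\<in>?S.
        (signof \<sigma> * (\<Prod>i<n. \<phi> (\<sigma> i) (x i))) * (signof \<tau> * (\<Prod>i<n. \<phi> (\<tau> i) (x i))))
        * (\<Prod>i<n. W (x i))))"
      unfolding F_def det power2_eq_square sum_product sum_distrib_right[of "\<lambda>k. f (x k)"] ..
    also have "\<dots> = (\<Sum>k<n. \<Sum>\<sigma>\<in>?S. \<Sum>\<tau>\<in>?S. signof \<sigma> * signof \<tau> *
        ((\<Prod>i<n. \<phi> (\<sigma> i) (x i)) * (\<Prod>i<n. \<phi> (\<tau> i) (x i)) * (\<Prod>i<n. W (x i)) * f (x k)))"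
      by (intro sum.cong refl) (simp only: sum_distrib_left sum_distrib_right mult_ac)
    also have "\<dots> = (\<Sum>k<n. \<Sum>\<sigma>\<in>?S. \<Sum>\<tau>\<in>?S. signof \<sigma> * signof \<tau> * (\<Prod>i<n. h k \<sigma> \<tau> i (x i)))"
      by (intro sum.cong refl) (simp add: h_def prod.distrib prod.delta)
    finally show ?thesis .
  qed
  then have F: "F = (\<lambda>x. \<Sum>k<n. \<Sum>\<sigma>\<in>?S. \<Sum>\<tau>\<in>?S. signof \<sigma> * signof \<tau> * (\<Prod>i<n. h k \<sigma> \<tau> i (x i)))"
    by blast
  have int_h: "integrable \<nu> (h k \<sigma> \<tau> i)" for k \<sigma> \<tau> i
    unfolding h_def using int intf by (cases "i = k") simp_all
  have int_prod: "integrable ?P (\<lambda>x. signof \<sigma> * signof \<tau> * (\<Prod>i<n. h k \<sigma> \<tau> i (x i)))" for k \<sigma> \<tau>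
    by (intro integrable_mult_right product_integrable_prod int_h) simp
  show "integrable ?P F"
    unfolding F by (intro Bochner_Integration.integrable_sum int_prod)
  have val: "(\<integral>x. signof \<sigma> * signof \<tau> * (\<Prod>i<n. h k \<sigma> \<tau> i (x i)) \<partial>?P)
      = (if \<tau> = \<sigma> then B (\<sigma> k) (\<sigma> k) else 0)"
    if kn: "k < n" and perm: "\<sigma> \<in> ?S" "\<tau> \<in> ?S" for k \<sigma> \<tau>
  proof -
    have ih: "integral\<^sup>L \<nu> (h k \<sigma> \<tau> i)
        = (if i = k then B (\<sigma> k) (\<tau> k) else if \<sigma> i = \<tau> i then 1 else 0)" for i
      unfolding h_def B_def using orth by (cases "i = k") simp_all
    have "(\<integral>x. signof \<sigma> * signof \<tau> * (\<Prod>i<n. h k \<sigma> \<tau> i (x i)) \<partial>?P)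
        = signof \<sigma> * signof \<tau> * (\<Prod>i<n. integral\<^sup>L \<nu> (h k \<sigma> \<tau> i))"
      by (simp only: integral_mult_right_zero product_integral_prod[OF finite_lessThan int_h])
    also have "\<dots> = (if \<tau> = \<sigma> then B (\<sigma> k) (\<sigma> k) else 0)"
    proof (cases "\<tau> = \<sigma>")
      case True
      moreover have "signof \<sigma> * signof \<sigma> = (1 :: complex)"
        by (simp add: sign_idempotent flip: of_int_mult)
      moreover have "integral\<^sup>L \<nu> (h k \<sigma> \<sigma> i) = (if i = k then B (\<sigma> k) (\<sigma> k) else 1)" for i
        using ih[of i] by (simp add: True)
      ultimately show ?thesis using kn by (simp add: True)
    next
      case False
      then obtain i where i: "i \<noteq> k" "\<sigma> i \<noteq> \<tau> i"
        using permutes_eqI_except[of \<sigma> "{..<n}" \<tau> k] perm by blast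
      then have "i < n"
        using perm by (metis lessThan_iff mem_Collect_eq permutes_def)
      then have "(\<Prod>i<n. integral\<^sup>L \<nu> (h k \<sigma> \<tau> i)) = 0"
        using i by (intro prod_zero) (auto simp: ih)
      then show ?thesis using False by simp
    qed
    finally show ?thesis .
  qed
  have "integral\<^sup>L ?P F = (\<Sum>k<n. \<Sum>\<sigma>\<in>?S. \<Sum>\<tau>\<in>?S.
      \<integral>x. signof \<sigma> * signof \<tau> * (\<Prod>i<n. h k \<sigma> \<tau> i (x i)) \<partial>?P)"
    unfolding F by (simp only: Bochner_Integration.integral_sum Bochner_Integration.integrable_sum int_prod)
  also have "\<dots> = (\<Sum>k<n. \<Sum>\<sigma>\<in>?S. \<Sum>\<tau>\<in>?S. if \<tau> = \<sigma> then B (\<sigma> k) (\<sigma> k) else 0)"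
    by (intro sum.cong refl val) auto
  also have "\<dots> = (\<Sum>k<n. \<Sum>\<sigma>\<in>?S. B (\<sigma> k) (\<sigma> k))"
    using fin by (intro sum.cong refl) (simp add: sum.delta')
  also have "\<dots> = (\<Sum>\<sigma>\<in>?S. \<Sum>k<n. B (\<sigma> k) (\<sigma> k))"
    by (rule sum.swap)
  \<comment> \<open>Reindexing by \<sigma> makes the inner sum independent of \<sigma>; the number
    of permutations then gives the factorial.\<close>
  also have "\<dots> = (\<Sum>\<sigma>\<in>?S. \<Sum>k<n. B k k)"
  proof (rule sum.cong[OF refl])
    fix \<sigma> assume "\<sigma> \<in> ?S"
    then show "(\<Sum>k<n. B (\<sigma> k) (\<sigma> k)) = (\<Sum>k<n. B k k)"
      using sum.permute[of \<sigma> "{..<n}" "\<lambda>k. B k k"] by (simp add: comp_def)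
  qed
  also have "\<dots> = fact n * (\<Sum>j<n. B j j)"
    by (simp add: card_permutations[of "{..<n}" n])
  finally show "integral\<^sup>L ?P F = fact n * (\<Sum>j<n. \<integral>t. \<phi> j t * \<phi> j t * W t * f t \<partial>\<nu>)"
    by (simp add: B_def)
qed

section \<open>Laplace transforms of Laguerre polynomials\<close>

lemma integral_power_exp_Ici_complex:
  fixes q :: complex
  assumes q: "Re q > 0"
  shows "integrable lborel (\<lambda>t::real. indicator {0..} t *\<^sub>R (of_real t ^ k * exp (- q * of_real t)))"
    and "(\<integral>t. indicator {0..} t *\<^sub>R (of_real t ^ k * exp (- q * of_real t)) \<partial>lborel)
      = fact k / q ^ Suc k"
proof -
  let ?f = "\<lambda>k (t::real). of_real t ^ k * exp (- q * of_real t) :: complex"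
  have int: "integrable lborel (\<lambda>t. indicator {0..} t *\<^sub>R ?f k t)" for k
  proof (rule Bochner_Integration.integrable_bound)
    \<comment> \<open>On the half-line the modulus of the integrand is a constant multiple of the
      Erlang density with rate \<open>Re q\<close>.\<close>
    have "integrable lborel (erlang_density k (Re q))"
    proof (rule integrableI_nonneg)
      have "(\<integral>\<^sup>+ x. ennreal (erlang_density k (Re q) x) \<partial>lborel) = 1"
        using nn_integral_erlang_ith_moment[OF q, of k 0] by (simp add: divide_ennreal)
      then show "(\<integral>\<^sup>+ x. ennreal (erlang_density k (Re q) x) \<partial>lborel) < \<infinity>" by simp
    qed (use q in auto)
    then show "integrable lborel (\<lambda>x. fact k / Re q ^ Suc k * erlang_density k (Re q) x)"
      by simp
    show "AE x in lborel. norm (indicator {0..} x *\<^sub>R ?f k x)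
        \<le> norm (fact k / Re q ^ Suc k * erlang_density k (Re q) x)"
    proof (rule AE_I2)
      fix x :: real
      show "norm (indicator {0..} x *\<^sub>R ?f k x)
          \<le> norm (fact k / Re q ^ Suc k * erlang_density k (Re q) x)"
      proof (cases "x \<ge> 0")
        case True
        have "norm (indicator {0..} x *\<^sub>R ?f k x) = x ^ k * exp (- Re q * x)"
          using True by (simp add: norm_mult norm_power)
        also have "\<dots> = fact k / Re q ^ Suc k * erlang_density k (Re q) x"
          using True q by (simp add: erlang_density_def)
        finally show ?thesis
          by (metis abs_ge_self real_norm_def)
      qed simp
    qed
  qed measurable
  show "integrable lborel (\<lambda>t. indicator {0..} t *\<^sub>R ?f k t)" by (rule int)
  define I where "I k = (\<integral>t. indicator {0..} t *\<^sub>R ?f k t \<partial>lborel)" for k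
  have lim: "((?f k) \<longlongrightarrow> 0) at_top" for k
  proof (rule tendsto_norm_zero_cancel)
    have "((\<lambda>t. t ^ k / exp (Re q * t)) \<longlongrightarrow> 0) at_top"
      using q by real_asymp
    moreover have "eventually (\<lambda>t. t ^ k / exp (Re q * t) = norm (?f k t)) at_top"
      using eventually_ge_at_top[of "0::real"]
    proof eventually_elim
      case (elim t)
      have "norm (?f k t) = t ^ k * exp (- (Re q * t))"
        using elim by (simp add: norm_mult norm_power)
      then show ?case by (simp add: exp_minus divide_inverse)
    qed
    ultimately show "((\<lambda>t. norm (?f k t)) \<longlongrightarrow> 0) at_top"
      by (rule Lim_transform_eventually)
  qed
  \<comment> \<open>Integrating the derivative of \<open>?f k\<close> leaves minus its value at 0,
    which is 1 for \<open>k = 0\<close> and 0 otherwise. For \<open>k = 0\<close> the truncated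
    index \<open>k - 1\<close> is harmless, being multiplied by 0.\<close>
  have rec: "of_nat k * I (k - 1) - q * I k = - (if k = 0 then 1 else 0)" for k
  proof -
    let ?g = "\<lambda>t. of_nat k * ?f (k - 1) t - q * ?f k t"
    have "(LBINT t=0..\<infinity>. ?g t) = 0 - (if k = 0 then 1 else 0)"
    proof (rule interval_integral_FTC_integrable[where F = "?f k"])
      show "(?f k has_vector_derivative ?g x) (at x)" for x
      proof -
        have "((\<lambda>z. z ^ k * exp (- q * z)) has_field_derivative
            (of_nat k * (of_real x ^ (k - 1) * exp (- q * of_real x))
              - q * (of_real x ^ k * exp (- q * of_real x)))) (at (of_real x))"
          by (auto intro!: derivative_eq_intros simp: algebra_simps)
        then show ?thesis
          by (rule has_vector_derivative_real_field)
      qed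
      show "isCont ?g x" for x by (intro continuous_intros)
      have "integrable lborel (\<lambda>t. of_nat k * (indicator {0..} t *\<^sub>R ?f (k - 1) t)
          - q * (indicator {0..} t *\<^sub>R ?f k t))"
        by (intro Bochner_Integration.integrable_diff integrable_mult_right int)
      then have "set_integrable lborel {0..} ?g"
        unfolding set_integrable_def by (rule Bochner_Integration.integrable_cong[THEN iffD1, rotated -1])
          (auto simp: indicator_def)
      then show "set_integrable lborel (einterval 0 \<infinity>) ?g"
        by (rule set_integrable_subset) (auto simp: einterval_def)
      have "(?f k \<longlongrightarrow> ?f k 0) (at_right 0)"
        by (intro tendsto_intros)
      then show "((?f k \<circ> real_of_ereal) \<longlongrightarrow> (if k = 0 then 1 else 0)) (at_right 0)"
        by (auto simp: ereal_tendsto_simps zero_ereal_def power_0_left)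
      show "((?f k \<circ> real_of_ereal) \<longlongrightarrow> 0) (at_left \<infinity>)"
        using lim[of k] by (simp add: ereal_tendsto_simps)
    qed auto
    moreover have "(LBINT t=0..\<infinity>. ?g t) = of_nat k * I (k - 1) - q * I k"
    proof -
      \<comment> \<open>The interval integral is taken over the open half-line; the endpoint 0 is a
        null set.\<close>
      have "(LBINT t=0..\<infinity>. ?g t) = (LBINT t:{0..}. ?g t)"
        unfolding zero_ereal_def interval_integral_to_infinity_eq
        unfolding set_lebesgue_integral_def
        by (rule integral_cong_AE, measurable)
           (use AE_lborel_singleton[of "0::real"] in \<open>auto elim!: eventually_mono simp: indicator_def\<close>)
      also have "\<dots> = (\<integral>t. of_nat k * (indicator {0..} t *\<^sub>R ?f (k - 1) t)
          - q * (indicator {0..} t *\<^sub>R ?f k t) \<partial>lborel)"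
        unfolding set_lebesgue_integral_def
        by (rule Bochner_Integration.integral_cong) (auto simp: indicator_def)
      also have "\<dots> = of_nat k * I (k - 1) - q * I k"
        unfolding I_def
        by (simp only: Bochner_Integration.integral_diff integrable_mult_right int integral_mult_right_zero)
      finally show ?thesis .
    qed
    ultimately show ?thesis by simp
  qed
  have "q \<noteq> 0" using q by auto
  have "I k = fact k / q ^ Suc k"
  proof (induction k)
    case 0
    show ?case using rec[of 0] \<open>q \<noteq> 0\<close> by (simp add: field_simps)
  next
    case (Suc k)
    show ?case using rec[of "Suc k"] \<open>q \<noteq> 0\<close> Suc by (simp add: field_simps)
  qed
  then show "(\<integral>t. indicator {0..} t *\<^sub>R ?f k t \<partial>lborel) = fact k / q ^ Suc k"
    by (simp add: I_def)
qed

section \<open>Residues of products of inverse powers\<close>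

lemma residue_sum:
  assumes "finite A" "open S" "z \<in> S" "\<And>a. a \<in> A \<Longrightarrow> f a holomorphic_on S - {z}"
  shows "residue (\<lambda>w. \<Sum>a\<in>A. f a w) z = (\<Sum>a\<in>A. residue (f a) z)"
  using assms
proof (induction A rule: finite_induct)
  case empty
  then show ?case by (simp add: residue_const)
next
  case (insert a A)
  then show ?case
    by (simp add: residue_add[of S] holomorphic_on_sum)
qed

lemma higher_deriv_inverse_power:
  fixes s z :: complex
  assumes "z \<noteq> s"
  shows "(deriv ^^ k) (\<lambda>z. 1 / (s - z) ^ Suc l) z = fact (k + l) / (fact l * (s - z) ^ Suc (k + l))"
  using assms
proof (induction k arbitrary: z)
  case 0
  then show ?case by simp
next
  case (Suc k)
  have "((\<lambda>z. inverse (s - z)) has_field_derivative inverse (s - z) ^ 2) (at z)"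
    using Suc.prems by (auto intro!: derivative_eq_intros simp: power2_eq_square)
  from DERIV_cmult[OF DERIV_power_Suc[OF this], of "fact (k + l) / fact l" "k + l"]
  have "((\<lambda>z. fact (k + l) / (fact l * (s - z) ^ Suc (k + l))) has_field_derivative
      fact (k + l) * of_nat (Suc (k + l)) / (fact l * (s - z) ^ Suc (Suc (k + l)))) (at z)"
    by (simp add: divide_inverse power_inverse power2_eq_square mult_ac)
  then have "((deriv ^^ k) (\<lambda>z. 1 / (s - z) ^ Suc l) has_field_derivative
      fact (k + l) * of_nat (Suc (k + l)) / (fact l * (s - z) ^ Suc (Suc (k + l)))) (at z)"
    \<comment> \<open>The induction hypothesis holds only away from \<open>s\<close>, so the
      derivative is transferred on that open set.\<close>
    by (rule has_field_derivative_transform_within_open[where S = "- {s}"])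
       (use Suc in auto)
  then show ?case
    by (simp add: DERIV_imp_deriv algebra_simps)
qed

text \<open>The residue is a Taylor coefficient of the factor regular at 0. For
  \<open>Re s > 0\<close> the value is also the Laplace transform at \<open>s\<close> of
  \<open>t ^ k / fact k * (t ^ l / fact l)\<close>: this is the link between integrals and
  residues.\<close>

lemma residue_inverse_powers:
  fixes s :: complex
  assumes "s \<noteq> 0"
  shows "residue (\<lambda>z. 1 / (z ^ Suc k * (s - z) ^ Suc l)) 0 = fact (k + l) / (fact k * fact l * s ^ Suc (k + l))"
proof -
  have "residue (\<lambda>z. (1 / (s - z) ^ Suc l) / z ^ Suc k) 0
      = (deriv ^^ k) (\<lambda>z. 1 / (s - z) ^ Suc l) 0 / fact k"
    by (rule residue_holomorphic_over_power'[where A = "- {s}"])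
       (use assms in \<open>auto intro!: holomorphic_intros\<close>)
  also have "(\<lambda>z. (1 / (s - z) ^ Suc l) / z ^ Suc k) = (\<lambda>z. 1 / (z ^ Suc k * (s - z) ^ Suc l))"
    by (simp add: fun_eq_iff mult.commute)
  finally show ?thesis
    using assms by (subst (asm) higher_deriv_inverse_power) (auto simp: mult_ac)
qed

section \<open>Laguerre polynomials and their Laplace transforms as residues\<close>

text \<open>The classical Laguerre polynomial \<open>L_j\<close> evaluated at
  \<open>a * t\<close>.\<close>

definition laguerre_poly :: "real \<Rightarrow> nat \<Rightarrow> real poly"
  where "laguerre_poly a j = (\<Sum>k\<le>j. monom ((- a) ^ k * of_nat (j choose k) / fact k) k)"

lemma poly_laguerre_poly:
  "poly (laguerre_poly a j) t = (\<Sum>k\<le>j. (- a) ^ k * of_nat (j choose k) / fact k * t ^ k)"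
  by (simp add: laguerre_poly_def poly_sum poly_monom)

lemma degree_laguerre_poly_le: "degree (laguerre_poly a j) \<le> j"
  unfolding laguerre_poly_def by (intro degree_sum_le) (auto intro: order_trans[OF degree_monom_le])

lemma coeff_laguerre_poly_top: "coeff (laguerre_poly a j) j = (- a) ^ j / fact j"
  by (simp add: laguerre_poly_def coeff_sum)

text \<open>The Laplace transform of \<open>L_i\<close> at \<open>z\<close> times that of
  \<open>L_j\<close> at \<open>s - z\<close>. The residue at 0 plays the role of the complex
  convolution that gives the transform of the product \<open>L_i L_j\<close> at
  \<open>s\<close>.\<close>

definition laguerre_kernel :: "complex \<Rightarrow> nat \<Rightarrow> nat \<Rightarrow> complex \<Rightarrow> complex"
  where "laguerre_kernel s i j z = ((1 - 1 / z) ^ i / z) * ((1 - 1 / (s - z)) ^ j / (s - z))"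

lemma one_minus_inverse_power_expand:
  fixes z :: complex
  shows "(1 - 1 / z) ^ i / z = (\<Sum>k\<le>i. (-1) ^ k * of_nat (i choose k) / z ^ Suc k)"
proof -
  have "(1 - 1 / z) ^ i = (- (1 / z) + 1) ^ i" by simp
  also have "\<dots> = (\<Sum>k\<le>i. of_nat (i choose k) * (- (1 / z)) ^ k)"
    by (simp only: binomial_ring power_one mult_1_right)
  also have "\<dots> / z = (\<Sum>k\<le>i. (-1) ^ k * of_nat (i choose k) / z ^ Suc k)"
    unfolding sum_divide_distrib
    by (intro sum.cong refl) (simp add: power_minus[of "1 / z"] power_divide mult_ac)
  finally show ?thesis .
qed

lemma residue_laguerre_kernel:
  assumes "s \<noteq> 0"
  shows "residue (laguerre_kernel s i j) 0
    = (\<Sum>k\<le>i. \<Sum>l\<le>j. (-1) ^ (k + l) * of_nat (i choose k) * of_nat (j choose l)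
        * (fact (k + l) / (fact k * fact l * s ^ Suc (k + l))))"
proof -
  let ?f = "\<lambda>k l z. (-1) ^ (k + l) * of_nat (i choose k) * of_nat (j choose l)
        * (1 / (z ^ Suc k * (s - z) ^ Suc l)) :: complex"
  have "laguerre_kernel s i j = (\<lambda>z. \<Sum>k\<le>i. \<Sum>l\<le>j. ?f k l z)"
    by (intro ext, unfold laguerre_kernel_def one_minus_inverse_power_expand sum_product)
       (intro sum.cong refl, simp add: power_add)
  moreover have S: "open (- {s})" "0 \<in> - {s}" using assms by auto
  moreover have f: "?f k l holomorphic_on - {s} - {0}" for k l
    by (auto intro!: holomorphic_intros)
  moreover have hol: "(\<lambda>z. 1 / (z ^ Suc k * (s - z) ^ Suc l)) holomorphic_on - {s} - {0}" for k l
    by (auto intro!: holomorphic_intros)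
  ultimately have "residue (laguerre_kernel s i j) 0 = (\<Sum>k\<le>i. \<Sum>l\<le>j. residue (?f k l) 0)"
    by (simp only: residue_sum[OF finite_atMost S holomorphic_on_sum[OF f]] residue_sum[OF finite_atMost S f])
  also have "\<dots> = (\<Sum>k\<le>i. \<Sum>l\<le>j. (-1) ^ (k + l) * of_nat (i choose k) * of_nat (j choose l)
        * (fact (k + l) / (fact k * fact l * s ^ Suc (k + l))))"
    by (simp only: residue_lmul[OF S hol] residue_inverse_powers[OF assms])
  finally show ?thesis .
qed

text \<open>Both sides expand into the same double sum, monomial by monomial, through the Gamma
  integral on one side and the residue of inverse powers on the other. The prefactor
  \<open>a\<close> and the powers of \<open>a\<close> in the coefficients cancel those of the rate
  \<open>a * s\<close>, so the value does not depend on \<open>a\<close>.\<close>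

lemma integral_laguerre_laplace:
  fixes i j :: nat
  assumes s: "Re s > 0" and a: "a > 0"
  defines "F \<equiv> (\<lambda>t. indicator {0..} t *\<^sub>R (of_real (a * poly (laguerre_poly a i) t * poly (laguerre_poly a j) t)
      * exp (- (of_real a * s) * of_real t)))"
  shows "integrable lborel F" and "integral\<^sup>L lborel F = residue (laguerre_kernel s i j) 0"
proof -
  let ?q = "of_real a * s"
  let ?h = "\<lambda>n (t::real). indicator {0..} t *\<^sub>R (of_real t ^ n * exp (- ?q * of_real t)) :: complex"
  let ?c = "\<lambda>k l. of_real (a * ((- a) ^ k * of_nat (i choose k) / fact k)
      * ((- a) ^ l * of_nat (j choose l) / fact l)) :: complex"
  have q: "Re ?q > 0" using s a by simp
  have "s \<noteq> 0" using s by auto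
  have F: "F = (\<lambda>t. \<Sum>k\<le>i. \<Sum>l\<le>j. ?c k l * ?h (k + l) t)"
  proof
    fix t :: real
    have "of_real (a * poly (laguerre_poly a i) t * poly (laguerre_poly a j) t) * exp (- ?q * of_real t)
        = (\<Sum>k\<le>i. \<Sum>l\<le>j. ?c k l * (of_real t ^ (k + l) * exp (- ?q * of_real t)))"
      unfolding poly_laguerre_poly mult.assoc sum_product
      by (simp add: sum_distrib_left sum_distrib_right power_add mult_ac)
    then show "F t = (\<Sum>k\<le>i. \<Sum>l\<le>j. ?c k l * ?h (k + l) t)"
      unfolding F_def by (simp add: scaleR_sum_right del: of_real_mult of_real_divide)
  qed
  have int: "integrable lborel (\<lambda>t. ?c k l * ?h (k + l) t)" for k l
    by (intro integrable_mult_right integral_power_exp_Ici_complex q)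
  show "integrable lborel F"
    unfolding F by (intro Bochner_Integration.integrable_sum int)
  have "integral\<^sup>L lborel F = (\<Sum>k\<le>i. \<Sum>l\<le>j. ?c k l * (fact (k + l) / ?q ^ Suc (k + l)))"
    unfolding F
    by (simp only: Bochner_Integration.integral_sum Bochner_Integration.integrable_sum int
          integral_mult_right_zero integral_power_exp_Ici_complex(2)[OF q])
  also have "\<dots> = residue (laguerre_kernel s i j) 0"
    unfolding residue_laguerre_kernel[OF \<open>s \<noteq> 0\<close>]
  proof (intro sum.cong refl)
    fix k l
    show "?c k l * (fact (k + l) / ?q ^ Suc (k + l)) = (-1) ^ (k + l) * of_nat (i choose k) * of_nat (j choose l)
        * (fact (k + l) / (fact k * fact l * s ^ Suc (k + l)))"
      using a \<open>s \<noteq> 0\<close>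
      by (simp add: power_minus[of "of_real a"] power_minus[of a] power_mult_distrib power_add divide_simps)
  qed
  finally show "integral\<^sup>L lborel F = residue (laguerre_kernel s i j) 0" .
qed

section \<open>Orthonormality\<close>

text \<open>At \<open>s = 1\<close> the brackets \<open>1 - 1 / z\<close> and
  \<open>1 - 1 / (1 - z)\<close> are mutually inverse, so the kernel reduces to
  \<open>1 / (z * (1 - z))\<close>.\<close>

lemma residue_laguerre_kernel_1_diag: "residue (laguerre_kernel 1 i i) 0 = 1"
proof -
  have "eventually (\<lambda>z. laguerre_kernel 1 i i z = 1 / (z ^ Suc 0 * (1 - z) ^ Suc 0)) (at 0)"
    using eventually_at_in_open[of "- {1}" "0::complex"]
  proof (rule eventually_mono)
    fix z :: complex assume "z \<in> - {1} - {0}"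
    then have z: "z \<noteq> 0" "1 - z \<noteq> 0" by auto
    have "(1 - 1 / z) ^ i * (1 - 1 / (1 - z)) ^ i = ((1 - 1 / z) * (1 - 1 / (1 - z))) ^ i"
      by (simp add: power_mult_distrib)
    also have "(1 - 1 / z) * (1 - 1 / (1 - z)) = 1"
      using z by (simp add: field_simps)
    finally show "laguerre_kernel 1 i i z = 1 / (z ^ Suc 0 * (1 - z) ^ Suc 0)"
      by (simp add: laguerre_kernel_def)
  qed auto
  then have "residue (laguerre_kernel 1 i i) 0 = residue (\<lambda>z. 1 / (z ^ Suc 0 * (1 - z) ^ Suc 0)) 0"
    by (rule residue_cong) simp
  also have "\<dots> = 1"
    by (subst residue_inverse_powers) auto
  finally show ?thesis .
qed

text \<open>After the inverse brackets cancel, the surplus power of \<open>- z / (1 - z)\<close>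
  removes the pole at 0.\<close>

lemma residue_laguerre_kernel_1_less:
  assumes "i < j"
  shows "residue (laguerre_kernel 1 i j) 0 = 0"
proof -
  \<comment> \<open>The surplus exponent is \<open>Suc d\<close>: one factor \<open>z\<close>
    cancels \<open>1 / z\<close>, and \<open>z ^ d\<close> remains.\<close>
  define d where "d = j - Suc i"
  have j: "j = Suc (i + d)" using assms by (simp add: d_def)
  let ?g = "\<lambda>z::complex. (- 1) ^ Suc d * z ^ d / (1 - z) ^ (d + 2)"
  have "eventually (\<lambda>z. laguerre_kernel 1 i j z = ?g z) (at 0)"
    using eventually_at_in_open[of "- {1}" "0::complex"]
  proof (rule eventually_mono)
    fix z :: complex assume "z \<in> - {1} - {0}"
    then have z: "z \<noteq> 0" "1 - z \<noteq> 0" by auto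
    have inv: "(1 - 1 / z) * (1 - 1 / (1 - z)) = 1" and e: "1 - 1 / (1 - z) = (- 1) * z / (1 - z)"
      using z by (simp_all add: field_simps)
    have "(1 - 1 / z) ^ i * (1 - 1 / (1 - z)) ^ j
        = ((1 - 1 / z) * (1 - 1 / (1 - z))) ^ i * (1 - 1 / (1 - z)) ^ Suc d"
      by (simp add: j power_mult_distrib power_add)
    also have "\<dots> = ((- 1) * z / (1 - z)) ^ Suc d"
      unfolding inv unfolding e by simp
    finally have prod: "(1 - 1 / z) ^ i * (1 - 1 / (1 - z)) ^ j = ((- 1) * z / (1 - z)) ^ Suc d" .
    have "laguerre_kernel 1 i j z = ((1 - 1 / z) ^ i * (1 - 1 / (1 - z)) ^ j) / (z * (1 - z))"
      by (simp add: laguerre_kernel_def)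
    also have "\<dots> = ((- 1) * z / (1 - z)) ^ Suc d / (z * (1 - z))"
      by (simp only: prod)
    also have "\<dots> = ?g z"
      using z unfolding power_divide power_mult_distrib by (simp add: divide_simps)
    finally show "laguerre_kernel 1 i j z = ?g z" .
  qed auto
  then have "residue (laguerre_kernel 1 i j) 0 = residue ?g 0"
    by (rule residue_cong) simp
  also have "\<dots> = 0"
    by (rule residue_holo[where s = "- {1}"]) (auto intro!: holomorphic_intros)
  finally show ?thesis .
qed

lemma residue_laguerre_kernel_1:
  "residue (laguerre_kernel 1 i j) 0 = (if i = j then 1 else 0)"
proof -
  \<comment> \<open>For \<open>j < i\<close> the kernel keeps its pole at 0, but the integral it
    represents is symmetric in the two indices.\<close>
  have sym: "residue (laguerre_kernel 1 i j) 0 = residue (laguerre_kernel 1 j i) 0"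
    using integral_laguerre_laplace(2)[of 1 1 i j] integral_laguerre_laplace(2)[of 1 1 j i]
    by (simp add: mult_ac)
  show ?thesis
    using residue_laguerre_kernel_1_less[of i j] residue_laguerre_kernel_1_less[of j i]
      residue_laguerre_kernel_1_diag sym
    by (cases i j rule: linorder_cases) auto
qed

section \<open>The telescoping sum and the contour integral\<close>

text \<open>On the diagonal the kernel is \<open>g ^ j / (z * (1 - u - z))\<close>, and
  \<open>g - 1\<close> equals \<open>u / (z * (1 - u - z))\<close>. Multiplying by \<open>u\<close>
  thus produces differences of consecutive powers of \<open>g\<close>.\<close>

lemma laguerre_kernel_telescope:
  fixes u z :: complex
  assumes "z \<noteq> 0" "z + u - 1 \<noteq> 0"
  shows "u * (\<Sum>j<n. laguerre_kernel (1 - u) j j z)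
    = (z - 1) ^ n / (z + u - 1) ^ n * ((z + u) ^ n / z ^ n) - 1"
proof -
  define g where "g = (z - 1) / (z + u - 1) * ((z + u) / z)"
  have nz: "1 - u - z \<noteq> 0" using assms(2) by (auto simp: algebra_simps)
  have "u * laguerre_kernel (1 - u) j j z = g ^ Suc j - g ^ j" for j
  proof -
    have e: "(1 - 1 / z) * (1 - 1 / (1 - u - z)) = g"
      using assms nz unfolding g_def by (simp add: divide_simps) (simp add: algebra_simps)
    have "laguerre_kernel (1 - u) j j z = g ^ j / (z * (1 - u - z))"
      unfolding e[symmetric] laguerre_kernel_def power_mult_distrib by simp
    moreover have "u / (z * (1 - u - z)) = g - 1"
      using assms nz unfolding g_def by (simp add: divide_simps) (simp add: algebra_simps)
    ultimately have "u * laguerre_kernel (1 - u) j j z = (g - 1) * g ^ j"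
      by (metis times_divide_eq_left times_divide_eq_right)
    then show ?thesis by (simp add: algebra_simps)
  qed
  then have "u * (\<Sum>j<n. laguerre_kernel (1 - u) j j z) = (\<Sum>j<n. g ^ Suc j - g ^ j)"
    by (simp only: sum_distrib_left)
  also have "\<dots> = g ^ n - 1"
    by (subst sum_lessThan_telescope) simp
  also have "g ^ n = (z - 1) ^ n / (z + u - 1) ^ n * ((z + u) ^ n / z ^ n)"
    by (simp add: g_def power_mult_distrib power_divide)
  finally show ?thesis .
qed

text \<open>The winding numbers leave only the residue at 0, and the constant 1 by which the
  integrand differs from the telescoped sum has none. Since \<open>u\<close> is not 1, the two poles
  are distinct.\<close>

lemma contour_integral_laguerre_kernel:
  fixes u :: complex
  assumes u: "u \<noteq> 1" and \<gamma>: "encircles_once_not \<gamma> 0 (1 - u)"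
  shows "contour_integral \<gamma> (\<lambda>z. (z - 1) ^ n / (z + u - 1) ^ n * ((z + u) ^ n / z ^ n))
    = 2 * pi * \<i> * (u * (\<Sum>j<n. residue (laguerre_kernel (1 - u) j j) 0))"
proof -
  let ?G = "\<lambda>z. (z - 1) ^ n / (z + u - 1) ^ n * ((z + u) ^ n / z ^ n)"
  have hol: "laguerre_kernel (1 - u) j j holomorphic_on - {1 - u} - {0}" for j
    unfolding laguerre_kernel_def by (auto intro!: holomorphic_intros)
  have "contour_integral \<gamma> ?G
      = 2 * pi * \<i> * (\<Sum>p\<in>{0, 1 - u}. winding_number \<gamma> p * residue ?G p)"
    by (rule Residue_theorem[where S = UNIV])
       (use \<gamma> in \<open>auto simp: encircles_once_not_def algebra_simps intro!: holomorphic_intros\<close>)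
  also have "(\<Sum>p\<in>{0, 1 - u}. winding_number \<gamma> p * residue ?G p) = residue ?G 0"
    using \<gamma> u by (simp add: encircles_once_not_def)
  also have "residue ?G 0 = residue (\<lambda>z. 1 + u * (\<Sum>j<n. laguerre_kernel (1 - u) j j z)) 0"
  proof (rule residue_cong)
    have "eventually (\<lambda>z. z \<in> - {1 - u} - {0}) (at 0)"
      using u by (intro eventually_at_in_open) auto
    then show "eventually (\<lambda>z. ?G z = 1 + u * (\<Sum>j<n. laguerre_kernel (1 - u) j j z)) (at 0)"
    proof eventually_elim
      case (elim z)
      then show ?case
        by (subst laguerre_kernel_telescope) (auto simp: algebra_simps)
    qed
  qed simp
  also have "\<dots> = u * (\<Sum>j<n. residue (laguerre_kernel (1 - u) j j) 0)"
  proof -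
    have S: "open (- {1 - u})" "0 \<in> - {1 - u}" using u by auto
    have sum: "(\<lambda>z. \<Sum>j<n. laguerre_kernel (1 - u) j j z) holomorphic_on - {1 - u} - {0}"
      by (intro holomorphic_on_sum hol)
    have "residue (\<lambda>z. 1 + u * (\<Sum>j<n. laguerre_kernel (1 - u) j j z)) 0
        = residue (\<lambda>z. 1) 0 + residue (\<lambda>z. u * (\<Sum>j<n. laguerre_kernel (1 - u) j j z)) 0"
      by (intro residue_add[OF S] holomorphic_intros sum)
    also have "\<dots> = u * (\<Sum>j<n. residue (laguerre_kernel (1 - u) j j) 0)"
      by (simp only: residue_const residue_lmul[OF S sum] residue_sum[OF finite_lessThan S hol]) simp
    finally show ?thesis .
  qed
  finally show ?thesis .
qed

section \<open>The Laguerre ensemble\<close>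

lemma laguerre_weight_eq_det:
  assumes N: "N > 0"
  obtains \<kappa> :: real where "\<And>x. complex_of_real (laguerre_weight N x) = of_real \<kappa> *
      ((det (mat N N (\<lambda>(i, j). complex_of_real (poly (laguerre_poly (real N) j) (x i)))))\<^sup>2
       * (\<Prod>i<N. indicator {0..} (x i) *\<^sub>R (of_real (real N) * exp (- of_real (real N) * of_real (x i)))))"
proof -
  \<comment> \<open>The determinant is \<open>D\<close> times the Vandermonde product, and each
    one-variable weight carries a factor \<open>N\<close>; hence the constant
    \<open>1 / (D\<^sup>2 * real N ^ N)\<close>.\<close>
  define D where "D = (\<Prod>j<N. coeff (laguerre_poly (real N) j) j)"
  have D: "D \<noteq> 0" using N by (simp add: D_def coeff_laguerre_poly_top)
  have "complex_of_real (laguerre_weight N x) = of_real (1 / (D\<^sup>2 * real N ^ N)) *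
      ((det (mat N N (\<lambda>(i, j). complex_of_real (poly (laguerre_poly (real N) j) (x i)))))\<^sup>2
       * (\<Prod>i<N. indicator {0..} (x i) *\<^sub>R (of_real (real N) * exp (- of_real (real N) * of_real (x i)))))" for x
  proof -
    let ?V = "\<Prod>i<N. \<Prod>k<i. x i - x k"
    have "mat N N (\<lambda>(i, j). complex_of_real (poly (laguerre_poly (real N) j) (x i)))
        = map_mat of_real (mat N N (\<lambda>(i, j). poly (laguerre_poly (real N) j) (x i)))"
      by (auto intro!: eq_matI)
    then have det: "det (mat N N (\<lambda>(i, j). complex_of_real (poly (laguerre_poly (real N) j) (x i))))
        = of_real (D * ?V)"
      by (simp only: of_real_hom.hom_det det_poly_eq_vandermonde[OF degree_laguerre_poly_le] D_def)
    have w: "(\<Prod>i<N. indicator {0..} (x i) *\<^sub>R (of_real (real N) * exp (- of_real (real N) * of_real (x i))))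
        = complex_of_real (\<Prod>i<N. indicator {0..} (x i) * (real N * exp (- real N * x i)))"
      by (simp add: scaleR_conv_of_real flip: exp_of_real)
    have "D\<^sup>2 * real N ^ N * laguerre_weight N x
        = (D * ?V)\<^sup>2 * (\<Prod>i<N. indicator {0..} (x i) * (real N * exp (- real N * x i)))"
    proof (cases "\<forall>i<N. 0 \<le> x i")
      case True
      then have "(\<Prod>i<N. indicator {0..} (x i) * (real N * exp (- real N * x i)))
          = (\<Prod>i<N. real N * exp (- real N * x i))"
        by (intro prod.cong refl) auto
      also have "\<dots> = real N ^ N * exp (- real N * (\<Sum>i<N. x i))"
        by (simp only: prod.distrib sum_distrib_left exp_sum[OF finite_lessThan]) simp
      finally have *: "(\<Prod>i<N. indicator {0..} (x i) * (real N * exp (- real N * x i)))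
          = real N ^ N * exp (- real N * (\<Sum>i<N. x i))" .
      show ?thesis
        unfolding * using True by (simp add: laguerre_weight_def prod_pairs_squared_diff power_mult_distrib)
    next
      case False
      then obtain i where i: "i < N" "\<not> 0 \<le> x i" by blast
      then have *: "(\<Prod>i<N. indicator {0..} (x i) * (real N * exp (- real N * x i))) = 0"
        by (intro prod_zero bexI[of _ i]) auto
      show ?thesis
        unfolding * laguerre_weight_def if_not_P[OF False] by simp
    qed
    then have "laguerre_weight N x = 1 / (D\<^sup>2 * real N ^ N) *
        ((D * ?V)\<^sup>2 * (\<Prod>i<N. indicator {0..} (x i) * (real N * exp (- real N * x i))))"
      using D N by (simp add: field_simps)
    then show ?thesis
      unfolding det w by (simp only: of_real_mult of_real_power)
  qed
  then show thesis by (rule that)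
qed

text \<open>One constant \<open>C\<close> serves all \<open>v\<close> with \<open>Re v < 1\<close>:
  it collects the density normalisation, the Vandermonde constant and the factorial, none of which
  depends on \<open>v\<close>. This allows it to be evaluated at a single \<open>v\<close>
  later.\<close>

lemma laguerre_ensemble_exp_sum:
  assumes N: "N > 0" and ens: "laguerre_ensemble N M H lam"
  obtains C where "\<And>v. Re v < 1 \<Longrightarrow>
    integrable M (\<lambda>\<omega>. \<Sum>k<N. exp (of_nat N * v * of_real (lam k \<omega>))) \<and>
    (\<integral>\<omega>. (\<Sum>k<N. exp (of_nat N * v * of_real (lam k \<omega>))) \<partial>M)
      = C * (\<Sum>j<N. residue (laguerre_kernel (1 - v) j j) 0)"
proof -
  let ?P = "\<Pi>\<^sub>M i\<in>{..<N}. (lborel :: real measure)"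
  let ?X = "\<lambda>\<omega>. \<lambda>i\<in>{..<N}. lam i \<omega>"
  obtain c where c: "c > 0"
    and dist: "distributed M ?P ?X (\<lambda>x. ennreal (c * laguerre_weight N x))"
    using ens unfolding laguerre_ensemble_def by blast
  obtain \<kappa> where \<kappa>: "\<And>x. complex_of_real (laguerre_weight N x) = of_real \<kappa> *
      ((det (mat N N (\<lambda>(i, j). complex_of_real (poly (laguerre_poly (real N) j) (x i)))))\<^sup>2
       * (\<Prod>i<N. indicator {0..} (x i) *\<^sub>R (of_real (real N) * exp (- of_real (real N) * of_real (x i)))))"
    using laguerre_weight_eq_det[OF N] by blast
  define \<phi> where "\<phi> j t = complex_of_real (poly (laguerre_poly (real N) j) t)" for j and t :: real
  define W where "W t = indicator {0..} t *\<^sub>R (complex_of_real (real N) * exp (- of_real (real N) * of_real t))"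
    for t :: real
  have nonneg: "0 \<le> c * laguerre_weight N x" for x
    using c by (auto simp: laguerre_weight_def intro!: mult_nonneg_nonneg prod_nonneg)
  have X[measurable]: "?X \<in> measurable M ?P"
    and distr: "distr M ?P ?X = density ?P (\<lambda>x. ennreal (c * laguerre_weight N x))"
    and meas: "(\<lambda>x. ennreal (c * laguerre_weight N x)) \<in> borel_measurable ?P"
    using dist by (auto simp: distributed_def)
  \<comment> \<open>Measurability of the real weight is recovered from that of the extended density,
    since the weight is nonnegative.\<close>
  have weight_meas[measurable]: "(\<lambda>x. c * laguerre_weight N x) \<in> borel_measurable ?P"
    using borel_measurable_enn2real[OF meas] nonneg by simp
  have moment: "integrable lborel (\<lambda>t. \<phi> a t * \<phi> b t * W t * exp (of_nat N * v * of_real t))"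
      "(\<integral>t. \<phi> a t * \<phi> b t * W t * exp (of_nat N * v * of_real t) \<partial>lborel)
        = residue (laguerre_kernel (1 - v) a b) 0" if "Re v < 1" for a b v
  proof -
    have "(\<lambda>t. \<phi> a t * \<phi> b t * W t * exp (of_nat N * v * of_real t))
      = (\<lambda>t. indicator {0..} t *\<^sub>R (of_real (real N * poly (laguerre_poly (real N) a) t * poly (laguerre_poly (real N) b) t)
          * exp (- (of_real (real N) * (1 - v)) * of_real t)))"
    proof
      fix t :: real
      have "exp (- (of_real (real N) * (1 - v)) * of_real t)
          = exp (- of_real (real N) * of_real t) * exp (of_nat N * v * of_real t)"
        by (simp add: algebra_simps flip: exp_add)
      then show "\<phi> a t * \<phi> b t * W t * exp (of_nat N * v * of_real t) = indicator {0..} t *\<^sub>R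
          (of_real (real N * poly (laguerre_poly (real N) a) t * poly (laguerre_poly (real N) b) t)
          * exp (- (of_real (real N) * (1 - v)) * of_real t))"
        by (simp only: \<phi>_def W_def of_real_mult scaleR_conv_of_real mult_ac)
    qed
    then show "integrable lborel (\<lambda>t. \<phi> a t * \<phi> b t * W t * exp (of_nat N * v * of_real t))"
      "(\<integral>t. \<phi> a t * \<phi> b t * W t * exp (of_nat N * v * of_real t) \<partial>lborel)
        = residue (laguerre_kernel (1 - v) a b) 0"
      using that N integral_laguerre_laplace[of "1 - v" "real N" a b] by simp_all
  qed
  \<comment> \<open>Orthonormality is the moment at \<open>v = 0\<close>, that is the kernel at
    \<open>s = 1\<close>.\<close>
  have orth: "integrable lborel (\<lambda>t. \<phi> a t * \<phi> b t * W t)"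
      "(\<integral>t. \<phi> a t * \<phi> b t * W t \<partial>lborel) = (if a = b then 1 else 0)" for a b
    using moment[of 0 a b] by (simp_all add: residue_laguerre_kernel_1)
  have "integrable M (\<lambda>\<omega>. \<Sum>k<N. exp (of_nat N * v * of_real (lam k \<omega>))) \<and>
    (\<integral>\<omega>. (\<Sum>k<N. exp (of_nat N * v * of_real (lam k \<omega>))) \<partial>M)
      = (of_real (c * \<kappa>) * fact N) * (\<Sum>j<N. residue (laguerre_kernel (1 - v) j j) 0)"
    if v: "Re v < 1" for v
  proof -
    let ?g = "\<lambda>x. \<Sum>k<N. exp (of_nat N * v * complex_of_real (x k))"
    let ?F = "\<lambda>x. ?g x * ((det (mat N N (\<lambda>(i, j). \<phi> j (x i))))\<^sup>2 * (\<Prod>i<N. W (x i)))"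
    note mean = orthonormal_determinantal_mean[where \<nu> = lborel and \<phi> = \<phi> and W = W and n = N
        and f = "\<lambda>t. exp (of_nat N * v * complex_of_real t)",
        OF lborel.sigma_finite_measure_axioms orth moment(1)[OF v]]
    have g[measurable]: "?g \<in> borel_measurable ?P"
      by measurable
    have weighted: "(\<lambda>x. (c * laguerre_weight N x) *\<^sub>R ?g x) = (\<lambda>x. of_real (c * \<kappa>) * ?F x)"
      by (simp only: scaleR_conv_of_real of_real_mult \<kappa> \<phi>_def W_def mult_ac)
    have gX: "?g (?X \<omega>) = (\<Sum>k<N. exp (of_nat N * v * of_real (lam k \<omega>)))" for \<omega>
      by (intro sum.cong refl) simp
    have "integrable (distr M ?P ?X) ?g"
      unfolding distr using nonneg mean(1)
      by (subst integrable_density) (auto simp: weighted)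
    then have "integrable M (\<lambda>\<omega>. ?g (?X \<omega>))"
      by (rule integrable_distr[OF X])
    moreover have "(\<integral>\<omega>. ?g (?X \<omega>) \<partial>M) = integral\<^sup>L (distr M ?P ?X) ?g"
      by (rule integral_distr[OF X g, symmetric])
    moreover have "\<dots> = (\<integral>x. (c * laguerre_weight N x) *\<^sub>R ?g x \<partial>?P)"
      unfolding distr using nonneg by (intro integral_density) auto
    moreover have "\<dots> = of_real (c * \<kappa>) * integral\<^sup>L ?P ?F"
      unfolding weighted by simp
    moreover have "\<dots> = (of_real (c * \<kappa>) * fact N) * (\<Sum>j<N. residue (laguerre_kernel (1 - v) j j) 0)"
      unfolding mean(2) moment(2)[OF v] by (rule mult.assoc[symmetric])
    ultimately show ?thesis
      by (simp only: gX)
  qed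
  then show thesis by (rule that)
qed

lemma laguerre_ensemble_mean_exp:
  assumes N: "N > 0" and ens: "laguerre_ensemble N M H lam" and v: "Re v < 1"
  shows "integrable M (\<lambda>\<omega>. \<Sum>k<N. exp (of_nat N * v * of_real (lam k \<omega>)))"
    and "(\<integral>\<omega>. (\<Sum>k<N. exp (of_nat N * v * of_real (lam k \<omega>))) \<partial>M)
      = (\<Sum>j<N. residue (laguerre_kernel (1 - v) j j) 0)"
proof -
  interpret prob_space M using ens by (simp add: laguerre_ensemble_def)
  obtain C where C: "\<And>v. Re v < 1 \<Longrightarrow>
    integrable M (\<lambda>\<omega>. \<Sum>k<N. exp (of_nat N * v * of_real (lam k \<omega>))) \<and>
    (\<integral>\<omega>. (\<Sum>k<N. exp (of_nat N * v * of_real (lam k \<omega>))) \<partial>M)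
      = C * (\<Sum>j<N. residue (laguerre_kernel (1 - v) j j) 0)"
    using laguerre_ensemble_exp_sum[OF N ens] by blast
  \<comment> \<open>At \<open>v = 0\<close> the mean is \<open>N\<close> because the total mass is
    1, while each of the \<open>N\<close> residues equals 1.\<close>
  have "C = 1" using C[of 0] N by (simp add: residue_laguerre_kernel_1 prob_space)
  with C[OF v] show "integrable M (\<lambda>\<omega>. \<Sum>k<N. exp (of_nat N * v * of_real (lam k \<omega>)))"
    "(\<integral>\<omega>. (\<Sum>k<N. exp (of_nat N * v * of_real (lam k \<omega>))) \<partial>M)
      = (\<Sum>j<N. residue (laguerre_kernel (1 - v) j j) 0)"
    by simp_all
qed

theorem proposition1:
  fixes N :: nat and M :: "'a measure"
    and H :: "'a \<Rightarrow> complex mat" and lam :: "nat \<Rightarrow> 'a \<Rightarrow> real"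
    and u :: complex and \<gamma> :: "real \<Rightarrow> complex"
  assumes "N > 0"
    and "laguerre_ensemble N M H lam"
    and "u \<noteq> 0" and "Re u < 1"
    and "encircles_once_not \<gamma> 0 (1 - u)"
  shows "integrable M (\<lambda>\<omega>. mat_trace (mat_exp ((of_nat N * u) \<cdot>\<^sub>m H \<omega>)))
    \<and> integral\<^sup>L M (\<lambda>\<omega>. mat_trace (mat_exp ((of_nat N * u) \<cdot>\<^sub>m H \<omega>)))
      = 1 / u * (1 / (2 * of_real pi * \<i>)) *
        contour_integral \<gamma> (\<lambda>z. (z - 1) ^ N / (z + u - 1) ^ N * ((z + u) ^ N / z ^ N))
    \<and> 1 / u * (1 / (2 * of_real pi * \<i>)) *
        contour_integral \<gamma> (\<lambda>z. (z - 1) ^ N / (z + u - 1) ^ N * ((z + u) ^ N / z ^ N))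
      = 1 / u * (1 / (2 * of_real pi * \<i>)) *
        contour_integral \<gamma> (\<lambda>z. (1 + 1 / (z + u - 1)) ^ N * (1 - 1 / z) ^ N)"
proof -
  let ?T = "\<lambda>\<omega>. mat_trace (mat_exp ((of_nat N * u) \<cdot>\<^sub>m H \<omega>))"
  have trace: "?T \<omega> = (\<Sum>k<N. exp (of_nat N * u * of_real (lam k \<omega>)))" if "\<omega> \<in> space M" for \<omega>
    using assms(2) that
    by (intro mat_trace_mat_exp_smult) (auto simp: laguerre_ensemble_def pos_def_hermitian_def)
  note mean = laguerre_ensemble_mean_exp[OF assms(1,2,4)]
  have "integrable M ?T"
    using mean(1) trace by (subst Bochner_Integration.integrable_cong[OF refl]) auto
  moreover have "integral\<^sup>L M ?T = 1 / u * (1 / (2 * of_real pi * \<i>)) *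
        contour_integral \<gamma> (\<lambda>z. (z - 1) ^ N / (z + u - 1) ^ N * ((z + u) ^ N / z ^ N))"
  proof -
    have "integral\<^sup>L M ?T = (\<Sum>j<N. residue (laguerre_kernel (1 - u) j j) 0)"
      unfolding mean(2)[symmetric] by (intro Bochner_Integration.integral_cong refl trace)
    moreover have "u \<noteq> 1" using assms(4) by auto
    ultimately show ?thesis
      using contour_integral_laguerre_kernel[of u \<gamma> N] assms(3,5) by simp
  qed
  moreover have "contour_integral \<gamma> (\<lambda>z. (z - 1) ^ N / (z + u - 1) ^ N * ((z + u) ^ N / z ^ N))
      = contour_integral \<gamma> (\<lambda>z. (1 + 1 / (z + u - 1)) ^ N * (1 - 1 / z) ^ N)"
  \<comment> \<open>The two integrands are compared on the contour only: at the poles, where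
    division by zero returns 0, they need not agree.\<close>
  proof (rule contour_integral_eq)
    fix z assume "z \<in> path_image \<gamma>"
    then have "z \<noteq> 0" "z \<noteq> 1 - u"
      using assms(5) by (auto simp: encircles_once_not_def)
    then have z: "z \<noteq> 0" "z + u - 1 \<noteq> 0"
      by (auto simp: algebra_simps)
    have "(z - 1) ^ N / (z + u - 1) ^ N * ((z + u) ^ N / z ^ N)
        = ((z + u) / (z + u - 1)) ^ N * ((z - 1) / z) ^ N"
      by (simp add: power_divide)
    also have "(z + u) / (z + u - 1) = 1 + 1 / (z + u - 1)"
      using z by (simp add: field_simps)
    also have "(z - 1) / z = 1 - 1 / z"
      using z by (simp add: field_simps)
    finally show "(z - 1) ^ N / (z + u - 1) ^ N * ((z + u) ^ N / z ^ N)
        = (1 + 1 / (z + u - 1)) ^ N * (1 - 1 / z) ^ N" .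
  qed
  ultimately show ?thesis by simp
qed

end
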